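(* Let $\mathscr{F}$ be a family of subsets of $\mathbb{N}$ such that all members of $\mathscr{F} \sqcap \mathscr{F}^*$ are infinite. If $\mathscr{F}^*$ is $\sigma$-compact, then for all $A \in \mathscr{F}$, there exists a disjoint partition $A = A_1 \cup A_2$ with $A_1, A_2 \in \mathscr{F}$.
   Context: $\mathbb{N}$ is the set of positive integers. A family is an upward-closed collection of subsets of $\mathbb{N}$. The dual of a family $\mathscr{F}$ is $\mathscr{F}^* = \{B \subseteq \mathbb{N} : B \cap A \neq \emptyset \text{ for all } A \in \mathscr{F}\}$. For nonempty families $\mathscr{F}, \mathscr{G}$, $\mathscr{F} \sqcap \mathscr{G} = \{A \cap B : A \in \mathscr{F}, B \in \mathscr{G}\}$; by convention $\emptyset \sqcap \mathscr{F} = \mathscr{F} \sqcap \emptyset = \mathscr{F}$. Write $[M] = \{0, 1, \ldots, M-1\}$. A family $\mathscr{G}$ is compact if for all $B \in \mathscr{G}^*$ there exists $M \in \mathbb{N}$ such that $B \cap [M] \in \mathscr{G}^*$. A family is $\sigma$-compact if it is the union of countably many compact families. *)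

theory Defs
  imports Main "HOL-Library.Countable_Set"
begin

text \<open>The ambient set is the set of positive integers, encoded as a subset of \<^typ>\<open>nat\<close>.\<close>

abbreviation posnats :: "nat set" where
  "posnats \<equiv> {n. 0 < n}"

definition is_family :: "nat set set \<Rightarrow> bool" where
  "is_family F \<longleftrightarrow> F \<subseteq> Pow posnats \<and> (\<forall>A\<in>F. \<forall>B. A \<subseteq> B \<and> B \<subseteq> posnats \<longrightarrow> B \<in> F)"

definition dual :: "nat set set \<Rightarrow> nat set set" where
  "dual F = {B. B \<subseteq> posnats \<and> (\<forall>A\<in>F. B \<inter> A \<noteq> {})}"

text \<open>The empty family is neutral for \<open>\<sqinter>\<close> by convention.\<close>

definition family_meet :: "nat set set \<Rightarrow> nat set set \<Rightarrow> nat set set"  (infixl \<open>\<sqinter>\<close> 70) where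
  "F \<sqinter> G = (if F = {} then G else if G = {} then F else {A \<inter> B | A B. A \<in> F \<and> B \<in> G})"

text \<open>Here \<open>{0..<M}\<close> is the paper's \<open>[M] = {0, 1, \<dots>, M - 1}\<close>.\<close>

definition compact_family :: "nat set set \<Rightarrow> bool" where
  "compact_family G \<longleftrightarrow> is_family G \<and> (\<forall>B\<in>dual G. \<exists>M\<in>posnats. B \<inter> {0..<M} \<in> dual G)"

definition sigma_compact_family :: "nat set set \<Rightarrow> bool" where
  "sigma_compact_family F \<longleftrightarrow>
     is_family F \<and> (\<exists>\<C>. countable \<C> \<and> (\<forall>G\<in>\<C>. compact_family G) \<and> F = \<Union>\<C>)"

end

theory Submission
  imports Defs
begin

text \<open>
  Since \<open>F\<close> is upward closed, it is its own double dual, so a set lies in \<open>F\<close> as soon as it meets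
  every member of \<open>dual F\<close>. Write \<open>dual F\<close> as the union of compact families \<open>G 0, G 1, \<dots>\<close>. A member
  \<open>A\<close> of \<open>F\<close> meets each member of \<open>dual F\<close> in an infinite set, so every tail of \<open>A\<close> still meets all
  of them, and compactness of \<open>G k\<close> cuts that tail down to a finite block that meets all members of
  \<open>G k\<close>. Hence \<open>A\<close> can be cut greedily into consecutive finite blocks, two of them for each \<open>G k\<close>.
  One block of each pair goes to \<open>A1\<close>, the other to \<open>A2\<close>; both parts then meet every member of
  every \<open>G k\<close>, that is, of \<open>dual F\<close>.
\<close>

text \<open>If \<open>A\<close> were not in \<open>F\<close>, no member of \<open>F\<close> would be contained in \<open>A\<close>, so the complement of
  \<open>A\<close> would belong to \<open>dual F\<close> without meeting \<open>A\<close>.\<close>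

lemma dual_dual_subset:
  assumes "is_family F"
  shows "dual (dual F) \<subseteq> F"
proof
  fix A assume A: "A \<in> dual (dual F)"
  then have "A \<subseteq> posnats" by (simp add: dual_def)
  show "A \<in> F"
  proof (rule ccontr)
    assume "A \<notin> F"
    have "posnats - A \<in> dual F"
      unfolding dual_def
    proof (intro CollectI conjI ballI)
      fix C assume "C \<in> F"
      with assms \<open>A \<notin> F\<close> \<open>A \<subseteq> posnats\<close> have "\<not> C \<subseteq> A" "C \<subseteq> posnats"
        unfolding is_family_def by blast+
      then show "(posnats - A) \<inter> C \<noteq> {}" by blast
    qed blast
    with A have "A \<inter> (posnats - A) \<noteq> {}" unfolding dual_def[of "dual F"] by blast
    then show False by blast
  qed
qed

lemma infinite_Int_dual:
  assumes "\<forall>C \<in> F \<sqinter> dual F. infinite C" "A \<in> F" "B \<in> dual F"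
  shows "infinite (A \<inter> B)"
proof -
  have "F \<noteq> {}" "dual F \<noteq> {}" using assms by blast+
  then have "F \<sqinter> dual F = {A \<inter> B | A B. A \<in> F \<and> B \<in> dual F}"
    unfolding family_meet_def by simp
  then show ?thesis using assms by blast
qed

text \<open>The infinite intersections let any initial segment of \<open>A\<close> be discarded before compactness is
  applied; this is what allows the blocks below to be chosen disjoint.\<close>

lemma compact_family_block:
  assumes "compact_family G" "A \<subseteq> posnats" and inf: "\<And>B. B \<in> G \<Longrightarrow> infinite (A \<inter> B)"
  shows "\<exists>M\<ge>N. A \<inter> {N..<M} \<in> dual G"
proof -
  have "A - {0..<N} \<in> dual G"
    unfolding dual_def
  proof (intro CollectI conjI ballI)
    fix B assume "B \<in> G"
    then have "infinite (A \<inter> B - {0..<N})" using inf by simp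
    then have "A \<inter> B - {0..<N} \<noteq> {}" by (metis finite.emptyI)
    then show "(A - {0..<N}) \<inter> B \<noteq> {}" by blast
  qed (use assms in blast)
  then obtain M where M: "(A - {0..<N}) \<inter> {0..<M} \<in> dual G"
    using assms unfolding compact_family_def by blast
  have "(A - {0..<N}) \<inter> {0..<M} = A \<inter> {N..<max N M}" by auto
  with M show ?thesis by (metis max.cobounded1)
qed

theorem proposition5p8:
  fixes F :: "nat set set"
  assumes "is_family F"
    and "\<forall>C \<in> F \<sqinter> dual F. infinite C"
    and "sigma_compact_family (dual F)"
  shows "\<forall>A\<in>F. \<exists>A1 A2. A = A1 \<union> A2 \<and> A1 \<inter> A2 = {} \<and> A1 \<in> F \<and> A2 \<in> F"
proof
  fix A assume A: "A \<in> F"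
  then have Apos: "A \<subseteq> posnats" using assms(1) unfolding is_family_def by blast
  obtain \<C> where \<C>: "countable \<C>" "\<forall>G\<in>\<C>. compact_family G" "dual F = \<Union>\<C>"
    using assms(3) unfolding sigma_compact_family_def by blast
  \<comment> \<open>An empty dual means that \<open>{}\<close> is a member of \<open>F\<close>, and then also of \<open>F \<sqinter> dual F = F\<close>, which
    has no finite member.\<close>
  have "dual F \<noteq> {}"
  proof
    assume "dual F = {}"
    then have "posnats \<notin> dual F" by simp
    then obtain C where "C \<in> F" "posnats \<inter> C = {}" unfolding dual_def by blast
    moreover from this have "C \<subseteq> posnats" using assms(1) unfolding is_family_def by blast
    ultimately have "{} \<in> F" by (metis inf.absorb2)
    moreover from this have "F \<sqinter> dual F = F" using \<open>dual F = {}\<close> unfolding family_meet_def by auto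
    ultimately show False using assms(2) by auto
  qed
  then have "\<C> \<noteq> {}" using \<C>(3) by blast
  define G where "G = from_nat_into \<C>"
  have rangeG: "range G = \<C>"
    unfolding G_def using \<open>\<C> \<noteq> {}\<close> \<C>(1) by (rule range_from_nat_into)
  have block: "\<exists>M\<ge>N. A \<inter> {N..<M} \<in> dual (G k)" for N k
  proof (rule compact_family_block)
    have "G k \<in> \<C>" using rangeG by blast
    then show "compact_family (G k)" using \<C>(2) by blast
    show "infinite (A \<inter> B)" if "B \<in> G k" for B
      using infinite_Int_dual[OF assms(2) A] that \<open>G k \<in> \<C>\<close> \<C>(3) by blast
  qed (rule Apos)
  \<comment> \<open>Blocks \<open>2 * k\<close> and \<open>2 * k + 1\<close> both serve \<open>G k\<close>.\<close>
  have "\<exists>M. \<forall>n. True \<and> (M n \<le> M (Suc n) \<and> A \<inter> {M n..<M (Suc n)} \<in> dual (G (n div 2)))"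
    by (rule dependent_nat_choice) (use block in blast)+
  then obtain M :: "nat \<Rightarrow> nat" where M: "\<And>n. M n \<le> M (Suc n)"
    and dualM: "\<And>n. A \<inter> {M n..<M (Suc n)} \<in> dual (G (n div 2))" by blast
  have "mono M" using M by (simp add: mono_iff_le_Suc)
  have disj: "{M m..<M (Suc m)} \<inter> {M n..<M (Suc n)} = {}" if "m \<noteq> n" for m n
  proof -
    have "M (Suc m) \<le> M n \<or> M (Suc n) \<le> M m"
      using that by (metis Suc_leI \<open>mono M\<close> monoD nat_neq_iff)
    then show ?thesis by auto
  qed
  have in_F: "X \<in> F" if "X \<subseteq> A" and X: "\<And>k. \<exists>n. n div 2 = k \<and> A \<inter> {M n..<M (Suc n)} \<subseteq> X" for X
  proof -
    have "X \<inter> B \<noteq> {}" if B: "B \<in> dual F" for B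
    proof -
      obtain k where k: "B \<in> G k" using B unfolding \<C>(3) rangeG[symmetric] by blast
      obtain n where n: "n div 2 = k" "A \<inter> {M n..<M (Suc n)} \<subseteq> X" using X[of k] by blast
      have "A \<inter> {M n..<M (Suc n)} \<inter> B \<noteq> {}"
        using dualM[of n] k unfolding n(1) dual_def by blast
      with n(2) show ?thesis by blast
    qed
    then have "X \<in> dual (dual F)" using \<open>X \<subseteq> A\<close> Apos unfolding dual_def[of "dual F"] by blast
    then show "X \<in> F" using dual_dual_subset[OF assms(1)] by blast
  qed
  define A1 where "A1 = A \<inter> (\<Union>k. {M (2 * k)..<M (Suc (2 * k))})"
  have "A1 \<subseteq> A" unfolding A1_def by blast
  have "A1 \<in> F"
  proof (rule in_F)
    fix k
    show "\<exists>n. n div 2 = k \<and> A \<inter> {M n..<M (Suc n)} \<subseteq> A1"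
      by (rule exI[of _ "2 * k"]) (auto simp: A1_def)
  qed (rule \<open>A1 \<subseteq> A\<close>)
  moreover have "A - A1 \<in> F"
  proof (rule in_F)
    fix k
    have "{M (Suc (2 * k))..<M (Suc (Suc (2 * k)))} \<inter> {M (2 * j)..<M (Suc (2 * j))} = {}" for j
      by (rule disj) presburger
    then have "A \<inter> {M (Suc (2 * k))..<M (Suc (Suc (2 * k)))} \<subseteq> A - A1"
      unfolding A1_def by blast
    then show "\<exists>n. n div 2 = k \<and> A \<inter> {M n..<M (Suc n)} \<subseteq> A - A1"
      by (intro exI[of _ "Suc (2 * k)"]) simp
  qed blast
  ultimately show "\<exists>A1 A2. A = A1 \<union> A2 \<and> A1 \<inter> A2 = {} \<and> A1 \<in> F \<and> A2 \<in> F"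
    by (intro exI[of _ A1] exI[of _ "A - A1"] conjI) (use \<open>A1 \<subseteq> A\<close> in blast)+
qed

end
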